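(* Let $a,b,c$ be integers and $r,s,t$ real numbers, let $(V_n)_{n\ge 0}$ be the associated generalized Tribonacci sequence, and let $\varphi_n$ be the $n$th generalized Tribonacci hyperbolic spinor. Then for all $n\ge 0$, $$\varphi_n=\begin{vmatrix} \varphi_0&-1&0&0&0&\cdots&0&0\\ \varphi_1&0&-1&0&0&\cdots&0&0\\ \varphi_2&0&0&-1&0&\cdots&0&0\\ 0&t&s&r&-1&\cdots&0&0\\ \vdots&\ddots&\ddots&\ddots&\ddots&\ddots&\vdots&\vdots\\ 0&0&0&0&0&\ddots&r&-1\\ 0&0&0&0&0&\ddots&s&r \end{vmatrix}_{(n+1)\times(n+1)}.$$ Explicitly, with rows and columns indexed by $0,1,\dots,n$, the matrix has entries: $\varphi_i$ at position $(i,0)$ for $i\in\{0,1,2\}$ with $i\le n$; $-1$ at position $(i,i+1)$ for $0\le i\le n-1$; $t,s,r$ at positions $(i,i-2),(i,i-1),(i,i)$ respectively for $3\le i\le n$; and $0$ elsewhere.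
   Context: Hyperbolic numbers are the elements $x+yj$ with $x,y\in\mathbb{R}$ and $j^2=1$ (a commutative ring). A hyperbolic spinor is a column vector with two hyperbolic number components; addition and scalar multiplication are componentwise. Given integers $a,b,c$ and real numbers $r,s,t$, the generalized Tribonacci sequence $(V_n)_{n\ge0}$ is defined by $V_0=a$, $V_1=b$, $V_2=c$ and $V_n=rV_{n-1}+sV_{n-2}+tV_{n-3}$ for $n\ge 3$. The $n$th generalized Tribonacci hyperbolic spinor is $\varphi_n=\begin{bmatrix} V_n+V_{n+3}j\\ -V_{n+1}+V_{n+2}j\end{bmatrix}$, $n\ge 0$. In the determinant only the first column contains spinors, all other entries being real scalars; the determinant is the spinor obtained by cofactor expansion along the first column (equivalently, it is computed separately for each of the two components). *)

theory Defs
  imports "HOL-Analysis.Cartesian_Space" "Jordan_Normal_Form.Determinant"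
begin

(* Both imports use the dollar sign for component access; here it means the Analysis one. *)
no_notation Matrix.vec_index (infixl "$" 100)

section \<open>Hyperbolic numbers\<close>

datatype hyperbolic = Hyperbolic (real_part: real) (hyp_part: real)

instantiation hyperbolic :: comm_ring_1
begin

definition "0 = Hyperbolic 0 0"
definition "1 = Hyperbolic 1 0"
definition "z + w = Hyperbolic (real_part z + real_part w) (hyp_part z + hyp_part w)"
definition "z - w = Hyperbolic (real_part z - real_part w) (hyp_part z - hyp_part w)"
definition "- z = Hyperbolic (- real_part z) (- hyp_part z)"
definition "z * w =
  Hyperbolic (real_part z * real_part w + hyp_part z * hyp_part w)
             (real_part z * hyp_part w + hyp_part z * real_part w)"

instance
  by standard
    (simp_all add: zero_hyperbolic_def one_hyperbolic_def plus_hyperbolic_def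
      minus_hyperbolic_def uminus_hyperbolic_def times_hyperbolic_def algebra_simps)

end

instantiation hyperbolic :: real_algebra_1
begin

definition "x *\<^sub>R z = Hyperbolic (x * real_part z) (x * hyp_part z)"

instance
  by standard
    (simp_all add: scaleR_hyperbolic_def plus_hyperbolic_def times_hyperbolic_def algebra_simps)

end

definition hyp_j :: hyperbolic where
  "hyp_j = Hyperbolic 0 1"

lemma hyp_j_squared: "hyp_j * hyp_j = 1"
  by (simp add: hyp_j_def times_hyperbolic_def one_hyperbolic_def)

lemma Hyperbolic_eq: "Hyperbolic x y = of_real x + of_real y * hyp_j"
  by (simp add: of_real_def hyp_j_def times_hyperbolic_def one_hyperbolic_def
      plus_hyperbolic_def scaleR_hyperbolic_def)

section \<open>Generalized Tribonacci hyperbolic spinors\<close>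

type_synonym spinor = "hyperbolic ^ 2"

fun gen_tribonacci :: "int \<Rightarrow> int \<Rightarrow> int \<Rightarrow> real \<Rightarrow> real \<Rightarrow> real \<Rightarrow> nat \<Rightarrow> real" where
  "gen_tribonacci a b c r s t 0 = of_int a"
| "gen_tribonacci a b c r s t (Suc 0) = of_int b"
| "gen_tribonacci a b c r s t (Suc (Suc 0)) = of_int c"
| "gen_tribonacci a b c r s t (Suc (Suc (Suc n))) =
     r * gen_tribonacci a b c r s t (Suc (Suc n))
     + s * gen_tribonacci a b c r s t (Suc n)
     + t * gen_tribonacci a b c r s t n"

definition tribonacci_spinor ::
    "int \<Rightarrow> int \<Rightarrow> int \<Rightarrow> real \<Rightarrow> real \<Rightarrow> real \<Rightarrow> nat \<Rightarrow> spinor" where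
  "tribonacci_spinor a b c r s t n =
     (let V = gen_tribonacci a b c r s t in
      vector [of_real (V n) + of_real (V (n + 3)) * hyp_j,
              - of_real (V (n + 1)) + of_real (V (n + 2)) * hyp_j])"

section \<open>Determinants with spinors in the first column\<close>

datatype entry = Spinor (the_spinor: spinor) | Scalar (the_scalar: real)

(* Cofactor expansion along the first column, for a matrix whose entries in column 0 are
   spinors and whose other entries are scalars. The cofactors of column 0 do not involve
   the entries of column 0, so the value of the_scalar on spinors is irrelevant. *)
definition spinor_det :: "entry mat \<Rightarrow> spinor" where
  "spinor_det M =
     (\<Sum>i<dim_row M. cofactor (map_mat the_scalar M) i 0 *\<^sub>R the_spinor (M $$ (i, 0)))"

lemma spinor_det_component:
  assumes M: "M \<in> carrier_mat (Suc n) (Suc n)"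
  shows "spinor_det M $ k =
    det (mat (Suc n) (Suc n) (\<lambda>(i, j).
      if j = 0 then the_spinor (M $$ (i, 0)) $ k else of_real (the_scalar (M $$ (i, j)))))"
    (is "_ = det ?N")
proof -
  interpret h: comm_ring_hom "of_real :: real \<Rightarrow> hyperbolic"
    by standard simp_all
  have N: "?N \<in> carrier_mat (Suc n) (Suc n)" by simp
  have cof: "cofactor ?N i 0 = of_real (cofactor (map_mat the_scalar M) i 0)"
    if "i < Suc n" for i
  proof -
    have "mat_delete ?N i 0 = map_mat of_real (mat_delete (map_mat the_scalar M) i 0)"
      using M that by (intro eq_matI) (auto simp: mat_delete_def)
    then show ?thesis by (simp add: cofactor_def)
  qed
  have "det ?N = (\<Sum>i<Suc n. ?N $$ (i, 0) * cofactor ?N i 0)"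
    by (rule laplace_expansion_column[OF N]) simp
  also have "\<dots> = (\<Sum>i<Suc n.
      (cofactor (map_mat the_scalar M) i 0 *\<^sub>R the_spinor (M $$ (i, 0))) $ k)"
    by (intro sum.cong refl)
      (simp add: cof vector_scaleR_component scaleR_conv_of_real[where 'a = hyperbolic] mult.commute)
  also have "\<dots> = spinor_det M $ k"
    using M by (simp add: spinor_det_def)
  finally show ?thesis by simp
qed

(* For i >= 3 the columns i - 2, i - 1, i of the entries t, s, r are written as conditions on
   j + 2, j + 1, j to avoid truncated subtraction. *)
definition tribonacci_matrix ::
    "int \<Rightarrow> int \<Rightarrow> int \<Rightarrow> real \<Rightarrow> real \<Rightarrow> real \<Rightarrow> nat \<Rightarrow> entry mat" where
  "tribonacci_matrix a b c r s t n =
     mat (n + 1) (n + 1) (\<lambda>(i, j).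
       if j = 0 then Spinor (if i \<le> 2 then tribonacci_spinor a b c r s t i else 0)
       else Scalar
        (if j = i + 1 then - 1
         else if i \<ge> 3 \<and> j + 2 = i then t
         else if i \<ge> 3 \<and> j + 1 = i then s
         else if i \<ge> 3 \<and> j = i then r
         else 0))"

end

theory Submission
  imports Defs
begin

text \<open>
  In either component, the determinant is that of a Hessenberg matrix with every
  superdiagonal entry equal to \<open>- 1\<close>. Such a determinant solves a recurrence: if
  \<open>x\<^sub>i = A\<^sub>i\<^sub>0 + (\<Sum>j<i. A i (j + 1) * x\<^sub>j)\<close>, then the vector \<open>p = (1, x\<^sub>0, \<dots>, x\<^bsub>n-1\<^esub>)\<close> is sent by \<open>A\<close>
  to a vector whose only nonzero entry is \<open>x\<^sub>n\<close>, in the last row. Multiplying by the adjugate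
  gives \<open>det A = x\<^sub>n\<close>, since the bottom left cofactor is \<open>1\<close>: its minor is lower triangular
  with diagonal entries \<open>- 1\<close> (\<open>det_hessenberg\<close>).

  For the matrix of the theorem the recurrence reads \<open>x\<^sub>i = \<phi>\<^sub>i\<close> for \<open>i \<le> 2\<close> and
  \<open>x\<^sub>i = r x\<^bsub>i-1\<^esub> + s x\<^bsub>i-2\<^esub> + t x\<^bsub>i-3\<^esub>\<close> afterwards. The spinors satisfy it because their components
  are linear combinations of shifts of the Tribonacci sequence (\<open>tribonacci_spinor_rec\<close>).
\<close>

lemma cofactor_hessenberg_corner:
  fixes A :: "nat \<Rightarrow> nat \<Rightarrow> 'a :: comm_ring_1"
  assumes superdiag: "\<And>i. i < n \<Longrightarrow> A i (Suc i) = - 1"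
    and above: "\<And>i j. Suc i < j \<Longrightarrow> j \<le> n \<Longrightarrow> A i j = 0"
  shows "cofactor (mat (Suc n) (Suc n) (\<lambda>(i, j). A i j)) n 0 = 1"
proof -
  let ?M = "mat (Suc n) (Suc n) (\<lambda>(i, j). A i j)"
  have minor: "mat_delete ?M n 0 = mat n n (\<lambda>(i, j). A i (Suc j))" (is "_ = ?L")
    by (intro eq_matI) (auto simp: mat_delete_def)
  have "det ?L = prod_list (diag_mat ?L)"
    by (rule det_lower_triangular[where n = n]) (auto simp: above)
  also have "\<dots> = (\<Prod>i<n. - 1)"
    by (simp add: prod_list_diag_prod superdiag lessThan_atLeast0)
  finally have "det ?L = (- 1) ^ n" by simp
  then show ?thesis
    by (simp add: cofactor_def minor flip: power_mult_distrib)
qed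

text \<open>
  The recurrence makes \<open>p\<close> a solution of \<open>A p = x\<^sub>n e\<^sub>n\<close>, because the superdiagonal entry of
  row \<open>i < n\<close> contributes \<open>- x\<^sub>i\<close> and cancels the rest of the row. This is Cramer's rule
  read for the coordinate \<open>p\<^sub>0 = 1\<close>.
\<close>
lemma det_hessenberg:
  fixes A :: "nat \<Rightarrow> nat \<Rightarrow> 'a :: comm_ring_1" and x :: "nat \<Rightarrow> 'a"
  assumes superdiag: "\<And>i. i < n \<Longrightarrow> A i (Suc i) = - 1"
    and above: "\<And>i j. Suc i < j \<Longrightarrow> j \<le> n \<Longrightarrow> A i j = 0"
    and rec: "\<And>i. i \<le> n \<Longrightarrow> x i = A i 0 + (\<Sum>j<i. A i (Suc j) * x j)"
  shows "det (mat (Suc n) (Suc n) (\<lambda>(i, j). A i j)) = x n"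
proof -
  define M where "M = mat (Suc n) (Suc n) (\<lambda>(i, j). A i j)"
  define p where "p k = (case k of 0 \<Rightarrow> 1 | Suc j \<Rightarrow> x j)" for k
  have M: "M \<in> carrier_mat (Suc n) (Suc n)" by (simp add: M_def)
  have row: "(\<Sum>k<Suc n. A i k * p k) = (if i = n then x n else 0)" if "i \<le> n" for i
  proof -
    have "(\<Sum>k<Suc n. A i k * p k) = A i 0 + (\<Sum>j<n. A i (Suc j) * x j)"
      by (subst sum.lessThan_Suc_shift) (simp add: p_def)
    also have "\<dots> = (if i = n then x n else 0)"
    proof (cases "i = n")
      case True
      then show ?thesis by (simp add: rec[of n, symmetric])
    next
      case False
      with that have i: "i < n" by simp
      have "(\<Sum>j<n. A i (Suc j) * x j) = (\<Sum>j<Suc i. A i (Suc j) * x j)"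
        using i by (intro sum.mono_neutral_right) (auto simp: above)
      also have "\<dots> = (\<Sum>j<i. A i (Suc j) * x j) - x i"
        by (simp add: superdiag i)
      finally show ?thesis
        using rec[OF that] i by simp
    qed
    finally show ?thesis .
  qed
  have column: "(\<Sum>i<Suc n. cofactor M i 0 * A i k) = (if k = 0 then det M else 0)"
    if "k \<le> n" for k
  proof -
    have "(adj_mat M * M) $$ (0, k) = (\<Sum>i<Suc n. cofactor M i 0 * A i k)"
      using that adj_mat(1)[OF M]
      by (simp add: M_def adj_mat_def scalar_prod_def lessThan_atLeast0 del: sum.lessThan_Suc sum.op_ivl_Suc)
    then show ?thesis
      using that by (auto simp: adj_mat(3)[OF M] split: if_splits)
  qed
  have "det M = (\<Sum>k<Suc n. (\<Sum>i<Suc n. cofactor M i 0 * A i k) * p k)"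
  proof -
    have "(\<Sum>k<Suc n. (\<Sum>i<Suc n. cofactor M i 0 * A i k) * p k) =
        (\<Sum>k<Suc n. if k = 0 then det M else 0)"
      by (intro sum.cong refl) (simp add: column p_def del: sum.lessThan_Suc)
    then show ?thesis by (simp del: sum.lessThan_Suc)
  qed
  also have "\<dots> = (\<Sum>i<Suc n. cofactor M i 0 * (\<Sum>k<Suc n. A i k * p k))"
    unfolding sum_distrib_left sum_distrib_right mult.assoc by (rule sum.swap)
  also have "\<dots> = (\<Sum>i<Suc n. cofactor M i 0 * (if i = n then x n else 0))"
    by (intro sum.cong refl) (simp add: row del: sum.lessThan_Suc)
  also have "\<dots> = cofactor M n 0 * x n"
    by simp
  also have "\<dots> = x n"
    unfolding M_def using cofactor_hessenberg_corner[of n A, OF superdiag above] by simp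
  finally show ?thesis by (simp add: M_def)
qed

lemma tribonacci_spinor_rec:
  "tribonacci_spinor a b c r s t (n + 3) =
     r *\<^sub>R tribonacci_spinor a b c r s t (n + 2)
     + s *\<^sub>R tribonacci_spinor a b c r s t (n + 1)
     + t *\<^sub>R tribonacci_spinor a b c r s t n"
  by (simp add: Finite_Cartesian_Product.vec_eq_iff forall_2 tribonacci_spinor_def Let_def numeral_3_eq_3
      scaleR_conv_of_real[where 'a = hyperbolic] algebra_simps)

theorem theorem3p14:
  fixes a b c :: int and r s t :: real and n :: nat
  shows "tribonacci_spinor a b c r s t n = spinor_det (tribonacci_matrix a b c r s t n)"
proof (subst Finite_Cartesian_Product.vec_eq_iff, rule allI)
  fix k :: 2
  define x where "x i = tribonacci_spinor a b c r s t i $ k" for i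
  define A :: "nat \<Rightarrow> nat \<Rightarrow> hyperbolic" where
    "A i j = (if j = 0 then if i \<le> 2 then x i else 0
       else if j = i + 1 then - 1
       else if i \<ge> 3 \<and> j + 2 = i then of_real t
       else if i \<ge> 3 \<and> j + 1 = i then of_real s
       else if i \<ge> 3 \<and> j = i then of_real r
       else 0)" for i j
  have x_rec: "x (Suc (Suc (Suc m))) =
      of_real r * x (Suc (Suc m)) + of_real s * x (Suc m) + of_real t * x m" for m
    using tribonacci_spinor_rec[of a b c r s t m]
    by (simp add: x_def scaleR_conv_of_real[where 'a = hyperbolic] numeral_3_eq_3)
  have A_rec: "x i = A i 0 + (\<Sum>j<i. A i (Suc j) * x j)" for i
  proof (cases "i \<le> 2")
    case True
    then show ?thesis by (simp add: A_def)
  next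
    case False
    then obtain m where i: "i = Suc (Suc (Suc m))"
      by (metis add_2_eq_Suc less_imp_Suc_add not_le add_Suc)
    have "(\<Sum>j<m. A i (Suc j) * x j) = 0"
      by (intro sum.neutral) (auto simp: A_def i)
    then have "(\<Sum>j<i. A i (Suc j) * x j) =
        of_real t * x m + of_real s * x (Suc m) + of_real r * x (Suc (Suc m))"
      by (simp add: i) (simp add: A_def)
    moreover have "A i 0 = 0" by (simp add: A_def i)
    ultimately show ?thesis by (simp add: x_rec i)
  qed
  have "spinor_det (tribonacci_matrix a b c r s t n) $ k =
      det (mat (Suc n) (Suc n) (\<lambda>(i, j). A i j))"
    by (subst spinor_det_component[where n = n])
      (auto simp: tribonacci_matrix_def A_def x_def
        intro!: arg_cong[where f = det] eq_matI)
  also have "\<dots> = x n"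
    by (rule det_hessenberg[OF _ _ A_rec]) (auto simp: A_def)
  finally show "tribonacci_spinor a b c r s t n $ k =
      spinor_det (tribonacci_matrix a b c r s t n) $ k"
    by (simp add: x_def)
qed

end
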